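(* $g^4(C_2^2)=4$, $g^4(C_2^3)=5$, $g^4(C_2^4)=7$, $g^4(C_2^5)=8$ and $g^4(C_2^6)=10$.
   Context: $C_2^r$ denotes the elementary abelian $2$-group of rank $r$. For a finite abelian group $G$ (written additively) and a positive integer $k$, the $k$-Harborth constant $g^k(G)$ is the smallest positive integer $t$ such that every subset $S\subseteq G$ with $|S|\ge t$ contains a subset $T$ with $|T|=k$ and $\sum_{x\in T}x=0$. *)

theory Defs
  imports "HOL-Analysis.Finite_Cartesian_Product" "HOL-Library.Z2" "HOL-Library.Numeral_Type"
begin

text \<open>
  The group \<open>C\<^sub>2\<^sup>r\<close> is the additive group of the type \<open>bit ^ r\<close>, where \<open>bit\<close> is the field of
  integers mod 2 and the index type \<open>r\<close> is a numeral type with \<open>r\<close> elements.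
\<close>

lemma UNIV_bit: "(UNIV :: bit set) = {0, 1}"
  by (auto intro: bit.exhaust)

instance bit :: finite
  by standard (simp add: UNIV_bit)

text \<open>
  The least element exists, since \<open>t = CARD('a) + 1\<close> satisfies the condition vacuously.
\<close>

definition harborth :: "nat \<Rightarrow> 'a::{ab_group_add, finite} itself \<Rightarrow> nat" where
  "harborth k (_ :: 'a itself) =
    (LEAST t. t > 0 \<and>
      (\<forall>S :: 'a set. card S \<ge> t \<longrightarrow> (\<exists>T. T \<subseteq> S \<and> card T = k \<and> (\<Sum>x\<in>T. x) = 0)))"

end

theory Submission
  imports Defs
begin

text \<open>
  Let \<open>S\<close> be a set of \<open>n\<close> elements of \<open>C\<^sub>2\<^sup>r\<close> without four distinct elements of sum zero.
  By the pigeonhole principle, among the \<open>2\<^sup>n\<^sup>-\<^sup>1\<close> subsets of \<open>S\<close> of even size at least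
  \<open>M = 2\<^sup>n\<^sup>-\<^sup>1\<^sup>-\<^sup>r\<close> have the same sum. The symmetric difference of two of them has even size and
  sum zero, so its size is at least 6, and Plotkin's bound for codes of minimum distance 6 gives
  \<open>12 (M - 1) \<le> n M\<close>. This fails for \<open>(r, n) = (2, 4), (3, 5), (4, 7), (5, 8), (6, 10)\<close>.
  Explicit sets of size \<open>n - 1\<close> show that these values of \<open>n\<close> are optimal.
\<close>

unbundle bit_operations_syntax

text \<open>Double counting of \<open>D\<close>, the sum of distances over ordered pairs of members
  of \<open>F\<close>: each pair of distinct members contributes at least \<open>d\<close>, while
  each point of \<open>S\<close> separates at most half of all ordered pairs.\<close>

lemma plotkin_bound:
  assumes S: "finite S" and F: "F \<subseteq> Pow S"
    and d: "\<And>A B. A \<in> F \<Longrightarrow> B \<in> F \<Longrightarrow> A \<noteq> B \<Longrightarrow> d \<le> card (sym_diff A B)"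
  shows "2 * d * (card F - 1) \<le> card S * card F"
proof (cases "F = {}")
  case False
  have fF: "finite F" using F S by (meson finite_Pow_iff finite_subset)
  define D where "D = (\<Sum>A\<in>F. \<Sum>B\<in>F. card (sym_diff A B))"
  have "card F * ((card F - 1) * d) = (\<Sum>A\<in>F. \<Sum>B\<in>F - {A}. d)"
    using fF by simp
  also have "\<dots> \<le> (\<Sum>A\<in>F. \<Sum>B\<in>F - {A}. card (sym_diff A B))"
    using d by (intro sum_mono) auto
  also have "\<dots> \<le> D"
    unfolding D_def using fF by (intro sum_mono sum_mono2) auto
  finally have lower: "card F * ((card F - 1) * d) \<le> D" .
  \<comment> \<open>The separated ordered pairs have one member in \<open>P\<close> and one in
    \<open>Q\<close>, so there are \<open>2 * (card P * card Q)\<close> of them, and 4pq is at most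
    the square of p + q.\<close>
  have col: "2 * (\<Sum>A\<in>F. \<Sum>B\<in>F. of_bool ((x \<in> A) \<noteq> (x \<in> B))) \<le> card F * card F" for x
  proof -
    define P where "P = {A \<in> F. x \<in> A}"
    define Q where "Q = {A \<in> F. x \<notin> A}"
    have card: "card F = card P + card Q"
      unfolding P_def Q_def using fF by (subst card_Un_disjoint[symmetric]) (auto intro: arg_cong[where f = card])
    have "(\<Sum>B\<in>F. of_bool ((x \<in> A) \<noteq> (x \<in> B))) = (if x \<in> A then card Q else card P)" for A
      using fF by (auto simp: P_def Q_def sum_of_bool_eq Int_def)
    then have "(\<Sum>A\<in>F. \<Sum>B\<in>F. of_bool ((x \<in> A) \<noteq> (x \<in> B))) = (\<Sum>A\<in>F. if x \<in> A then card Q else card P)"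
      by simp
    also have "\<dots> = 2 * (card P * card Q)"
      using fF by (simp add: sum.If_cases P_def Q_def Int_def)
    finally have sum_eq: "(\<Sum>A\<in>F. \<Sum>B\<in>F. of_bool ((x \<in> A) \<noteq> (x \<in> B))) = 2 * (card P * card Q)" .
    have "real (2 * (card P * card Q)) \<le> real (card P * card P + card Q * card Q)"
      using sum_squares_bound[of "real (card P)" "real (card Q)"] by (simp add: power2_eq_square)
    then have "2 * (card P * card Q) \<le> card P * card P + card Q * card Q"
      by (simp only: of_nat_le_iff)
    then show ?thesis unfolding card sum_eq by (simp add: algebra_simps)
  qed
  have "card (sym_diff A B) = (\<Sum>x\<in>S. of_bool ((x \<in> A) \<noteq> (x \<in> B)))" if "A \<in> F" "B \<in> F" for A B
  proof -
    have "S \<inter> {x. (x \<in> A) \<noteq> (x \<in> B)} = sym_diff A B" using that F by auto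
    then show ?thesis using S by (simp add: sum_of_bool_eq)
  qed
  then have "D = (\<Sum>A\<in>F. \<Sum>B\<in>F. \<Sum>x\<in>S. of_bool ((x \<in> A) \<noteq> (x \<in> B)))"
    unfolding D_def by simp
  also have "\<dots> = (\<Sum>A\<in>F. \<Sum>x\<in>S. \<Sum>B\<in>F. of_bool ((x \<in> A) \<noteq> (x \<in> B)))"
    by (intro sum.cong refl sum.swap)
  also have "\<dots> = (\<Sum>x\<in>S. \<Sum>A\<in>F. \<Sum>B\<in>F. of_bool ((x \<in> A) \<noteq> (x \<in> B)))"
    by (rule sum.swap)
  finally have "2 * D = (\<Sum>x\<in>S. 2 * (\<Sum>A\<in>F. \<Sum>B\<in>F. of_bool ((x \<in> A) \<noteq> (x \<in> B))))"
    by (simp add: sum_distrib_left)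
  also have "\<dots> \<le> (\<Sum>x\<in>S. card F * card F)"
    using col by (rule sum_mono)
  finally have "2 * D \<le> card S * (card F * card F)" by simp
  with lower have "card F * (2 * d * (card F - 1)) \<le> card F * (card S * card F)"
    by (simp add: algebra_simps)
  then show ?thesis using False fF by (simp add: card_gt_0_iff)
qed simp

text \<open>Once a point \<open>a\<close> is fixed, the rest of an even subset is arbitrary, and
  parity decides whether \<open>a\<close> belongs to it.\<close>

lemma card_even_subsets:
  assumes "finite S" "S \<noteq> {}"
  shows "card {A. A \<subseteq> S \<and> even (card A)} = 2 ^ (card S - 1)"
proof -
  obtain a where a: "a \<in> S" using assms by auto
  define f where "f A = (if even (card A) then A else insert a A)" for A
  have card_f: "even (card (f A))" if "A \<subseteq> S - {a}" for A
  proof -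
    have "finite A" "a \<notin> A" using that assms(1) finite_subset[of A S] by auto
    then show ?thesis by (simp add: f_def)
  qed
  have "bij_betw f (Pow (S - {a})) {A. A \<subseteq> S \<and> even (card A)}"
  proof (rule bij_betwI[where g = "\<lambda>A. A - {a}"])
    have "f A \<subseteq> S" if "A \<subseteq> S - {a}" for A
      using that a by (auto simp: f_def)
    then show "f \<in> Pow (S - {a}) \<rightarrow> {A. A \<subseteq> S \<and> even (card A)}"
      using card_f by blast
    show "f (A - {a}) = A" if "A \<in> {A. A \<subseteq> S \<and> even (card A)}" for A
    proof (cases "a \<in> A")
      case True
      then have "card A = Suc (card (A - {a}))"
        using that assms(1) finite_subset[of A S] by (metis card.remove mem_Collect_eq)
      with that have "odd (card (A - {a}))" by (metis even_Suc mem_Collect_eq)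
      with True show ?thesis unfolding f_def by (simp only: if_False insert_Diff)
    qed (use that in \<open>auto simp: f_def\<close>)
  qed (auto simp: f_def)
  then have "card {A. A \<subseteq> S \<and> even (card A)} = card (Pow (S - {a}))"
    by (rule bij_betw_same_card[symmetric])
  also have "\<dots> = 2 ^ (card S - 1)"
    using a assms(1) by (simp add: card_Pow)
  finally show ?thesis .
qed

lemma even_card_sym_diff:
  assumes "finite A" "finite B" "even (card A)" "even (card B)"
  shows "even (card (sym_diff A B))"
proof -
  have "card A = card (A - B) + card (A \<inter> B)" "card B = card (B - A) + card (A \<inter> B)"
    using assms by (metis Int_Diff_Un Int_Diff_disjoint add.commute card_Un_disjoint finite_Diff finite_Int inf_commute)+
  moreover have "card (sym_diff A B) = card (A - B) + card (B - A)"
    using assms by (intro card_Un_disjoint) auto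
  ultimately show ?thesis using assms by presburger
qed

text \<open>The intersection is counted twice on the right, and its contribution cancels in exponent
  2.\<close>

lemma sum_sym_diff_exponent_2:
  fixes f :: "'b \<Rightarrow> 'a::ab_group_add"
  assumes "\<And>x::'a. x + x = 0" "finite A" "finite B"
  shows "sum f (sym_diff A B) = sum f A + sum f B"
proof -
  have "sum f A + sum f B = sum f (A - B) + sum f (B - A) + (sum f (A \<inter> B) + sum f (A \<inter> B))"
    using sum.Int_Diff[of A f B] sum.Int_Diff[of B f A] assms
    by (simp add: algebra_simps Int_commute)
  also have "\<dots> = sum f (sym_diff A B)"
    using assms by (subst sum.union_disjoint) auto
  finally show ?thesis by simp
qed

text \<open>The first inequality on \<open>M\<close> lets the pigeonhole principle find
  \<open>M\<close> even subsets with equal sums; the second contradicts \<open>plotkin_bound\<close>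
  at distance 6.\<close>

lemma zero_sum_4_subset_exists:
  fixes S :: "'a::{ab_group_add, finite} set"
  assumes exp2: "\<And>x::'a. x + x = 0"
    and n: "n \<le> card S" "0 < n" and M: "CARD('a) * M \<le> 2 ^ (n - 1)" "n * M < 12 * (M - 1)"
  shows "\<exists>T\<subseteq>S. card T = 4 \<and> \<Sum>T = 0"
proof (rule ccontr)
  assume no4: "\<not> ?thesis"
  obtain S' where S': "S' \<subseteq> S" "card S' = n"
    using n by (meson obtain_subset_with_card_n)
  define E where "E = {A. A \<subseteq> S' \<and> even (card A)}"
  have cardE: "card E = 2 ^ (n - 1)"
    unfolding E_def using S' n by (subst card_even_subsets) auto
  obtain y where "card E \<le> card ((\<lambda>A. \<Sum>A) -` {y} \<inter> E) * CARD('a)"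
    using pigeonhole_card[of "\<lambda>A. \<Sum>A" E "UNIV :: 'a set"] by auto
  moreover have "(\<lambda>A. \<Sum>A) -` {y} \<inter> E = {A \<in> E. \<Sum>A = y}" by auto
  ultimately have "CARD('a) * M \<le> CARD('a) * card {A \<in> E. \<Sum>A = y}"
    using M(1) cardE by (metis le_trans mult.commute)
  then have "M \<le> card {A \<in> E. \<Sum>A = y}" by simp
  \<comment> \<open>The fibre may be larger; cutting it down to exactly \<open>M\<close> sets lets
    the second inequality on \<open>M\<close> apply as it stands.\<close>
  then obtain F where F: "F \<subseteq> {A \<in> E. \<Sum>A = y}" "card F = M"
    by (meson obtain_subset_with_card_n)
  have "6 \<le> card (sym_diff A B)" if "A \<in> F" "B \<in> F" "A \<noteq> B" for A B
  proof -
    let ?D = "sym_diff A B"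
    have even: "even (card ?D)"
      using that F by (intro even_card_sym_diff) (auto simp: E_def)
    have "A \<subseteq> S'" "B \<subseteq> S'" using that F(1) by (auto simp: E_def)
    then have sub: "?D \<subseteq> S" using S'(1) by blast
    have zero: "\<Sum>?D = 0"
    proof -
      have "\<Sum>A = y" "\<Sum>B = y" using that(1,2) F(1) by auto
      then show ?thesis by (simp add: sum_sym_diff_exponent_2 exp2)
    qed
    have "card ?D \<noteq> 0" using that by auto
    moreover have "card ?D \<noteq> 4" using no4 sub zero by blast
    \<comment> \<open>Every element is its own negative, so two elements of sum zero
      coincide.\<close>
    moreover have "card ?D \<noteq> 2"
    proof
      assume "card ?D = 2"
      then obtain u v where uv: "?D = {u, v}" "u \<noteq> v" by (meson card_2_iff)
      then have "u + v = v + v" using zero exp2 by simp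
      with uv show False by simp
    qed
    ultimately show ?thesis using even by presburger
  qed
  moreover have "F \<subseteq> Pow S'" using F by (auto simp: E_def)
  ultimately have "2 * 6 * (card F - 1) \<le> card S' * card F"
    by (intro plotkin_bound) auto
  with F S' M show False by simp
qed

text \<open>One set of size \<open>m\<close> without such a \<open>T\<close> rules out every
  threshold up to \<open>m\<close>.\<close>

lemma harborth_eqI:
  fixes S :: "'a::{ab_group_add, finite} set"
  assumes "\<And>S::'a set. Suc m \<le> card S \<Longrightarrow> \<exists>T\<subseteq>S. card T = k \<and> \<Sum>T = 0"
    and "card S = m" "\<not> (\<exists>T\<subseteq>S. card T = k \<and> \<Sum>T = 0)"
  shows "harborth k TYPE('a) = Suc m"
  unfolding harborth_def
proof (rule Least_equality)
  fix t assume "0 < t \<and> (\<forall>S::'a set. card S \<ge> t \<longrightarrow> (\<exists>T. T \<subseteq> S \<and> card T = k \<and> \<Sum>T = 0))"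
  with assms(2,3) show "Suc m \<le> t" by (metis not_less_eq_eq)
qed (use assms(1) in auto)

text \<open>A vector of \<open>C\<^sub>2\<^sup>r\<close> is encoded by the natural number whose binary digits are its coordinates.\<close>

definition xor_sidon :: "nat set \<Rightarrow> bool" where
  "xor_sidon X \<longleftrightarrow> (\<forall>a\<in>X. \<forall>b\<in>X - {a}. \<forall>c\<in>X - {a, b}. a XOR b XOR c \<notin> X - {a, b, c})"

text \<open>Reading off binary digits turns \<open>XOR\<close> into addition, so four distinct
  vectors of sum zero would give a number in \<open>X\<close> that is the \<open>XOR\<close> of
  three others.\<close>

lemma bit_vector_sidon_set_exists:
  fixes X :: "nat set"
  assumes X: "X \<subseteq> {..<2 ^ CARD('n::finite)}"
    and sidon: "xor_sidon X"
  shows "\<exists>S :: (bit ^ 'n) set. card S = card X \<and> \<not> (\<exists>T\<subseteq>S. card T = 4 \<and> \<Sum>T = 0)"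
proof -
  \<comment> \<open>An arbitrary numbering of the coordinates assigns a digit position to each
    index.\<close>
  obtain h :: "'n \<Rightarrow> nat" where h: "bij_betw h UNIV {0..<CARD('n)}"
    using ex_bij_betw_finite_nat[of "UNIV :: 'n set"] by auto
  define g :: "nat \<Rightarrow> bit ^ 'n" where "g m = (\<chi> i. of_bool (bit m (h i)))" for m
  have g_xor: "g (m XOR k) = g m + g k" for m k
    by (auto simp: g_def vec_eq_iff bit_xor_iff)
  have g_inj: "m = k" if "g m = g k" "m < 2 ^ CARD('n)" "k < 2 ^ CARD('n)" for m k
  proof (rule bit_eqI)
    fix j
    show "bit m j \<longleftrightarrow> bit k j"
    proof (cases "j < CARD('n)")
      case True
      then obtain i where "j = h i"
        using h by (metis atLeastLessThan_iff bij_betw_imp_surj_on imageE zero_le)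
      then show ?thesis using that(1) by (simp add: g_def vec_eq_iff) (metis of_bool_eq_iff)
    next
      case False
      then have "\<not> bit x j" if "x < 2 ^ CARD('n)" for x :: nat
        using that by (metis bit_take_bit_iff take_bit_nat_eq_self)
      then show ?thesis using that by blast
    qed
  qed
  have inj: "inj_on g X" using X g_inj by (auto simp: inj_on_def)
  have "\<not> (\<exists>T\<subseteq>g ` X. card T = 4 \<and> \<Sum>T = 0)"
  proof
    assume "\<exists>T\<subseteq>g ` X. card T = 4 \<and> \<Sum>T = 0"
    then obtain Y where Y: "Y \<subseteq> X" "card (g ` Y) = 4" "\<Sum>(g ` Y) = 0"
      by (metis subset_imageE)
    have injY: "inj_on g Y" using inj Y(1) by (rule inj_on_subset)
    then have "card Y = 4" using Y(2) by (simp add: card_image)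
    then obtain a b c d where abcd: "Y = {a, b, c, d}" "a \<noteq> b" "a \<noteq> c" "a \<noteq> d" "b \<noteq> c" "b \<noteq> d" "c \<noteq> d"
      by (auto simp: card_Suc_eq numeral_eq_Suc)
    have "(\<Sum>x\<in>Y. g x) = 0" using Y(3) injY by (simp add: sum.reindex)
    then have "g a + g b + g c + g d = 0" using abcd by (simp add: add.assoc)
    moreover have "g d + g d = 0" by (simp add: vec_eq_iff)
    ultimately have "g (a XOR b XOR c) = g d"
      by (metis g_xor add.assoc add_right_cancel)
    \<comment> \<open>Injectivity of \<open>g\<close> holds only below this bound;
      \<open>XOR\<close> respects it because it commutes with truncation.\<close>
    moreover have "a XOR b XOR c < 2 ^ CARD('n)"
    proof -
      have "a < 2 ^ CARD('n)" "b < 2 ^ CARD('n)" "c < 2 ^ CARD('n)"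
        using abcd(1) Y(1) X by auto
      then have "take_bit CARD('n) (a XOR b XOR c) = a XOR b XOR c"
        by (simp only: take_bit_xor take_bit_nat_eq_self)
      then show ?thesis by (simp only: take_bit_nat_eq_self_iff)
    qed
    ultimately have "a XOR b XOR c = d"
      using abcd(1) Y(1) X by (intro g_inj) auto
    moreover have "a \<in> X" "b \<in> X - {a}" "c \<in> X - {a, b}" "d \<in> X - {a, b, c}"
      using abcd Y(1) by auto
    ultimately show False using sidon unfolding xor_sidon_def by metis
  qed
  then show ?thesis using card_image[OF inj] by (intro exI[of _ "g ` X"] conjI)
qed

text \<open>The upper bound is used for sets of \<open>Suc m\<close> elements, whose even subsets
  number \<open>2 ^ m\<close>.\<close>

lemma harborth_4_bit_vector_eqI:
  fixes X :: "nat set"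
  assumes "X \<subseteq> {..<2 ^ CARD('n::finite)}" "card X = m"
    and "xor_sidon X"
    and "2 ^ CARD('n) * M \<le> (2 :: nat) ^ m" "Suc m * M < 12 * (M - 1)"
  shows "harborth 4 TYPE(bit ^ 'n) = Suc m"
proof -
  obtain S :: "(bit ^ 'n) set" where S: "card S = m" "\<not> (\<exists>T\<subseteq>S. card T = 4 \<and> \<Sum>T = 0)"
    using bit_vector_sidon_set_exists[OF assms(1)] assms(2,3) by blast
  have "CARD(bit ^ 'n) = 2 ^ CARD('n)" by (simp add: UNIV_bit numeral_2_eq_2)
  then show ?thesis
    using assms(4,5) S
    by (intro harborth_eqI zero_sum_4_subset_exists[where n = "Suc m" and M = M]) (auto simp: vec_eq_iff)
qed

theorem theorem3p9:
  shows "harborth 4 TYPE(bit ^ 2) = 4 \<and>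
         harborth 4 TYPE(bit ^ 3) = 5 \<and>
         harborth 4 TYPE(bit ^ 4) = 7 \<and>
         harborth 4 TYPE(bit ^ 5) = 8 \<and>
         harborth 4 TYPE(bit ^ 6) = 10"
proof (intro conjI)
  \<comment> \<open>Zero and the standard basis are affinely independent; the same choice serves
    rank 3.\<close>
  have "xor_sidon {0, 1, 2}"
    by (simp add: xor_sidon_def insert_Diff_if)
  then show "harborth 4 TYPE(bit ^ 2) = 4"
    using harborth_4_bit_vector_eqI[where 'n = 2 and X = "{0, 1, 2}" and m = 3 and M = 2]
    by simp
  have "xor_sidon {0, 1, 2, 4}"
    by (simp add: xor_sidon_def insert_Diff_if)
  then show "harborth 4 TYPE(bit ^ 3) = 5"
    using harborth_4_bit_vector_eqI[where 'n = 3 and X = "{0, 1, 2, 4}" and m = 4 and M = 2]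
    by simp
  \<comment> \<open>The all-ones vector 15 has weight 4, so it is not a sum of three vectors among
    zero and the basis.\<close>
  have "xor_sidon {0, 1, 2, 4, 8, 15}"
    by (simp add: xor_sidon_def insert_Diff_if)
  then show "harborth 4 TYPE(bit ^ 4) = 7"
    using harborth_4_bit_vector_eqI[where 'n = 4 and X = "{0, 1, 2, 4, 8, 15}" and m = 6 and M = 4]
    by simp
  \<comment> \<open>The new basis vector 16 is independent of the previous set.\<close>
  have "xor_sidon {0, 1, 2, 4, 8, 15, 16}"
    by (simp add: xor_sidon_def insert_Diff_if)
  then show "harborth 4 TYPE(bit ^ 5) = 8"
    using harborth_4_bit_vector_eqI[where 'n = 5 and X = "{0, 1, 2, 4, 8, 15, 16}" and m = 7 and M = 4]
    by simp
  \<comment> \<open>Besides zero and the basis, 15 and 60 overlap in two digits, so that they and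
    their sum 51 all have weight 4, too much for the at most three remaining vectors of a
    quadruple.\<close>
  have "xor_sidon {0, 1, 2, 4, 8, 16, 32, 15, 60}"
    by (simp add: xor_sidon_def insert_Diff_if)
  then show "harborth 4 TYPE(bit ^ 6) = 10"
    using harborth_4_bit_vector_eqI[where 'n = 6 and X = "{0, 1, 2, 4, 8, 16, 32, 15, 60}" and m = 9 and M = 8]
    by simp
qed

end
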